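(* Let $\mu>0$ and $L>0$, and let $$V(r)=\left(\frac{L^2}{r^2}+1\right)\left(1-\frac{\mu}{r}\right),\qquad r>0.$$ If $\frac{L}{\mu}<\sqrt3$, then $V$ has no local extrema on $(0,\infty)$. If $\frac{L}{\mu}>\sqrt3$, then $V$ has exactly two local extrema on $(0,\infty)$, located at $$r_\pm=\frac{L^2}{\mu}\pm L\sqrt{\frac{L^2}{\mu^2}-3},$$ both of which are positive; the larger one $r_+$ is a local minimum and the smaller one $r_-$ is a local maximum.
   Context: $V$ is the effective potential for timelike plane geodesics with angular momentum $L$ in the Tangherlini spacetime with $d=3$ space dimensions (the Schwarzschild spacetime) and mass parameter $\mu$; in general dimension $V(r)=\left(\frac{L^2}{r^2}+1\right)\left(1-\frac{\mu}{r^{d-2}}\right)$. *)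

theory Defs
  imports "HOL-Analysis.Analysis"
begin

definition local_min_on :: "real set \<Rightarrow> (real \<Rightarrow> real) \<Rightarrow> real \<Rightarrow> bool" where
  "local_min_on S f x \<longleftrightarrow> x \<in> S \<and> (\<forall>\<^sub>F y in at x within S. f x \<le> f y)"

definition local_max_on :: "real set \<Rightarrow> (real \<Rightarrow> real) \<Rightarrow> real \<Rightarrow> bool" where
  "local_max_on S f x \<longleftrightarrow> x \<in> S \<and> (\<forall>\<^sub>F y in at x within S. f y \<le> f x)"

definition local_extremum_on :: "real set \<Rightarrow> (real \<Rightarrow> real) \<Rightarrow> real \<Rightarrow> bool" where
  "local_extremum_on S f x \<longleftrightarrow> local_min_on S f x \<or> local_max_on S f x"

text \<open>
  The effective potential of a timelike plane geodesic with angular momentum \<open>L\<close> in the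
  Schwarzschild spacetime with mass parameter \<open>\<mu>\<close>, that is, the Tangherlini potential
  \<open>(L\<^sup>2 / r\<^sup>2 + 1) * (1 - \<mu> / r ^ (d - 2))\<close> for \<open>d = 3\<close>. Only \<open>r > 0\<close> is meaningful.
\<close>

definition effective_potential :: "real \<Rightarrow> real \<Rightarrow> real \<Rightarrow> real" where
  "effective_potential \<mu> L r = (L\<^sup>2 / r\<^sup>2 + 1) * (1 - \<mu> / r)"

end

theory Submission
  imports Defs
begin

text \<open>
  In terms of \<open>u = 1 / r\<close> the potential is the cubic \<open>1 - \<mu> u + L\<^sup>2 u\<^sup>2 - \<mu> L\<^sup>2 u\<^sup>3\<close>. Its derivative in
  \<open>r\<close> has the sign of the quadratic \<open>\<mu> r\<^sup>2 - 2 L\<^sup>2 r + 3 \<mu> L\<^sup>2\<close>, whose roots are \<open>r\<^sub>\<plusminus>\<close>. At a critical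
  point \<open>x\<close> the Taylor expansion of the cubic shows that the difference to the critical value is
  \<open>(1 / r - 1 / x)\<^sup>2\<close> times a factor that tends to \<open>L\<^sup>2 (1 - 3 \<mu> / x)\<close>. Hence \<open>x\<close> is a minimum if
  \<open>x > 3 \<mu>\<close> and a maximum if \<open>x < 3 \<mu>\<close>, and \<open>r\<^sub>+ r\<^sub>- = 3 L\<^sup>2\<close> places \<open>3 \<mu>\<close> between the two roots.
\<close>

text \<open>Fermat's criterion for extrema relative to a set. Openness of \<open>S\<close> turns the
  relative neighbourhoods of \<open>x\<close> into full ones, as \<open>DERIV_local_min\<close> and
  \<open>DERIV_local_max\<close> require.\<close>

lemma local_extremum_on_imp_deriv_zero:
  assumes S: "open S" and ext: "local_extremum_on S f x"
    and D: "(f has_real_derivative D) (at x)"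
  shows "D = 0"
proof -
  have "x \<in> S"
    using ext by (auto simp: local_extremum_on_def local_min_on_def local_max_on_def)
  then have at: "at x within S = at x"
    using S by (rule at_within_open)
  from ext consider "\<forall>\<^sub>F y in at x. f x \<le> f y" | "\<forall>\<^sub>F y in at x. f y \<le> f x"
    by (auto simp: local_extremum_on_def local_min_on_def local_max_on_def at)
  then show ?thesis
  proof cases
    case 1
    then obtain d where "d > 0" "\<forall>y. y \<noteq> x \<and> dist y x < d \<longrightarrow> f x \<le> f y"
      by (auto simp: eventually_at)
    then have "\<forall>y. \<bar>x - y\<bar> < d \<longrightarrow> f x \<le> f y"
      by (metis abs_minus_commute dist_real_def order_refl)
    with D \<open>d > 0\<close> show ?thesis by (rule DERIV_local_min)
  next
    case 2
    then obtain d where "d > 0" "\<forall>y. y \<noteq> x \<and> dist y x < d \<longrightarrow> f y \<le> f x"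
      by (auto simp: eventually_at)
    then have "\<forall>y. \<bar>x - y\<bar> < d \<longrightarrow> f y \<le> f x"
      by (metis abs_minus_commute dist_real_def order_refl)
    with D \<open>d > 0\<close> show ?thesis by (rule DERIV_local_max)
  qed
qed

lemma effective_potential_has_derivative:
  assumes "r \<noteq> 0"
  shows "(effective_potential \<mu> L has_real_derivative
    (\<mu> * r\<^sup>2 - 2 * L\<^sup>2 * r + 3 * \<mu> * L\<^sup>2) / r ^ 4) (at r)"
proof -
  have "((\<lambda>r. (L\<^sup>2 / r\<^sup>2 + 1) * (1 - \<mu> / r)) has_real_derivative
    (- (L\<^sup>2 * (2 * r)) / (r\<^sup>2 * r\<^sup>2)) * (1 - \<mu> / r) + (L\<^sup>2 / r\<^sup>2 + 1) * (\<mu> / (r * r))) (at r)"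
    using assms by (auto intro!: derivative_eq_intros)
  moreover have "(- (L\<^sup>2 * (2 * r)) / (r\<^sup>2 * r\<^sup>2)) * (1 - \<mu> / r) + (L\<^sup>2 / r\<^sup>2 + 1) * (\<mu> / (r * r)) =
    (\<mu> * r\<^sup>2 - 2 * L\<^sup>2 * r + 3 * \<mu> * L\<^sup>2) / r ^ 4"
    using assms by (simp add: divide_simps) (simp add: algebra_simps eval_nat_numeral)
  ultimately show ?thesis
    by (simp add: effective_potential_def [abs_def])
qed

text \<open>Confines the extrema to positive roots of the quadratic. This excludes them below the
  threshold and bounds the set of extrema from above beyond it.\<close>

lemma local_extremum_effective_potential_imp_quadratic:
  assumes "local_extremum_on {0<..} (effective_potential \<mu> L) r"
  shows "0 < r" and "\<mu> * r\<^sup>2 - 2 * L\<^sup>2 * r + 3 * \<mu> * L\<^sup>2 = 0"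
proof -
  show r: "0 < r"
    using assms by (auto simp: local_extremum_on_def local_min_on_def local_max_on_def)
  have "(\<mu> * r\<^sup>2 - 2 * L\<^sup>2 * r + 3 * \<mu> * L\<^sup>2) / r ^ 4 = 0"
    using local_extremum_on_imp_deriv_zero [OF open_greaterThan assms
        effective_potential_has_derivative] r by simp
  with r show "\<mu> * r\<^sup>2 - 2 * L\<^sup>2 * r + 3 * \<mu> * L\<^sup>2 = 0" by simp
qed

text \<open>Exact Taylor expansion at \<open>u = 1 / x\<close> of the cubic \<open>p\<close> in
  \<open>v = 1 / y\<close>: the linear term vanishes, the quadratic coefficient is
  \<open>L\<^sup>2 * (1 - 3 * \<mu> * u)\<close> and the cubic one is
  \<open>- \<mu> * L\<^sup>2\<close>; together they give the last factor.\<close>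

lemma effective_potential_diff_critical:
  assumes "x \<noteq> 0" "y \<noteq> 0" and crit: "\<mu> * x\<^sup>2 - 2 * L\<^sup>2 * x + 3 * \<mu> * L\<^sup>2 = 0"
  shows "effective_potential \<mu> L y - effective_potential \<mu> L x =
    L\<^sup>2 * (1 / y - 1 / x)\<^sup>2 * (1 - 2 * \<mu> / x - \<mu> / y)"
proof -
  define u v where "u = 1 / x" and "v = 1 / y"
  have "(\<mu> * x\<^sup>2 - 2 * L\<^sup>2 * x + 3 * \<mu> * L\<^sup>2) * u\<^sup>2 = 0"
    using crit by simp
  \<comment> \<open>This is \<open>p'(u) = 0\<close>, solved for the constant term.\<close>
  then have u: "\<mu> = 2 * L\<^sup>2 * u - 3 * \<mu> * L\<^sup>2 * u\<^sup>2"
    using assms(1) by (simp add: u_def field_simps power2_eq_square)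
  \<comment> \<open>This covers \<open>w = 0\<close> as well: division by zero yields 0, so both
    sides are 1.\<close>
  have V: "effective_potential \<mu> L (1 / w) = 1 - \<mu> * w + L\<^sup>2 * w\<^sup>2 - \<mu> * L\<^sup>2 * w ^ 3" for w
    by (simp add: effective_potential_def power_divide algebra_simps power2_eq_square power3_eq_cube)
  \<comment> \<open>What remains on the right is the linear Taylor term
    \<open>p'(u) * (v - u)\<close>.\<close>
  have "effective_potential \<mu> L (1 / v) - effective_potential \<mu> L (1 / u)
      - L\<^sup>2 * (v - u)\<^sup>2 * (1 - 2 * \<mu> * u - \<mu> * v)
      = (u - v) * (\<mu> - (2 * L\<^sup>2 * u - 3 * \<mu> * L\<^sup>2 * u\<^sup>2))"
    unfolding V by (simp add: algebra_simps power2_eq_square power3_eq_cube)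
  then have "effective_potential \<mu> L (1 / v) - effective_potential \<mu> L (1 / u)
      = L\<^sup>2 * (v - u)\<^sup>2 * (1 - 2 * \<mu> * u - \<mu> * v)"
    using u by simp
  then show ?thesis
    by (simp add: u_def v_def)
qed

lemma tendsto_critical_factor:
  fixes x :: real
  assumes "0 < x"
  shows "((\<lambda>y. 1 - 2 * \<mu> / x - \<mu> / y) \<longlongrightarrow> 1 - 3 * \<mu> / x) (at x within {0<..})"
proof -
  have "((\<lambda>y. 1 - 2 * \<mu> / x - \<mu> / y) \<longlongrightarrow> 1 - 2 * \<mu> / x - \<mu> / x) (at x within {0<..})"
    using assms by (intro tendsto_intros) auto
  then show ?thesis by (simp add: field_simps)
qed

text \<open>Supplies \<open>y \<noteq> 0\<close> for the difference formula at points near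
  \<open>x\<close>.\<close>

lemma eventually_at_within_pos: "\<forall>\<^sub>F y in at x within {0<..}. 0 < (y::real)"
  by (simp add: eventually_at_filter)

lemma local_min_effective_potential:
  assumes crit: "\<mu> * x\<^sup>2 - 2 * L\<^sup>2 * x + 3 * \<mu> * L\<^sup>2 = 0" and x: "0 < x" "3 * \<mu> < x"
  shows "local_min_on {0<..} (effective_potential \<mu> L) x"
proof -
  have "0 < 1 - 3 * \<mu> / x" using x by simp
  then have "\<forall>\<^sub>F y in at x within {0<..}. 0 < 1 - 2 * \<mu> / x - \<mu> / y"
    by (rule order_tendstoD(1) [OF tendsto_critical_factor [OF x(1)]])
  then have "\<forall>\<^sub>F y in at x within {0<..}. effective_potential \<mu> L x \<le> effective_potential \<mu> L y"
    using eventually_at_within_pos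
  proof eventually_elim
    case (elim y)
    then have x_nz: "x \<noteq> 0" and y_nz: "y \<noteq> 0"
      using x by auto
    from elim have "0 \<le> L\<^sup>2 * (1 / y - 1 / x)\<^sup>2 * (1 - 2 * \<mu> / x - \<mu> / y)"
      by (intro mult_nonneg_nonneg) auto
    then show ?case
      using effective_potential_diff_critical [OF x_nz y_nz crit] by linarith
  qed
  with x show ?thesis by (simp add: local_min_on_def)
qed

lemma local_max_effective_potential:
  assumes crit: "\<mu> * x\<^sup>2 - 2 * L\<^sup>2 * x + 3 * \<mu> * L\<^sup>2 = 0" and x: "0 < x" "x < 3 * \<mu>"
  shows "local_max_on {0<..} (effective_potential \<mu> L) x"
proof -
  have "1 - 3 * \<mu> / x < 0" using x by simp
  then have "\<forall>\<^sub>F y in at x within {0<..}. 1 - 2 * \<mu> / x - \<mu> / y < 0"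
    by (rule order_tendstoD(2) [OF tendsto_critical_factor [OF x(1)]])
  then have "\<forall>\<^sub>F y in at x within {0<..}. effective_potential \<mu> L y \<le> effective_potential \<mu> L x"
    using eventually_at_within_pos
  proof eventually_elim
    case (elim y)
    then have x_nz: "x \<noteq> 0" and y_nz: "y \<noteq> 0"
      using x by auto
    from elim have "L\<^sup>2 * (1 / y - 1 / x)\<^sup>2 * (1 - 2 * \<mu> / x - \<mu> / y) \<le> 0"
      by (intro mult_nonneg_nonpos) auto
    then show ?case
      using effective_potential_diff_critical [OF x_nz y_nz crit] by linarith
  qed
  with x show ?thesis by (simp add: local_max_on_def)
qed

theorem mainTheorem3:
  fixes \<mu> L :: real
  assumes "\<mu> > 0" and "L > 0"
  shows
    "(L / \<mu> < sqrt 3 \<longrightarrow>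
        (\<nexists>r. local_extremum_on {0<..} (effective_potential \<mu> L) r)) \<and>
     (L / \<mu> > sqrt 3 \<longrightarrow>
        (let r\<^sub>p = L\<^sup>2 / \<mu> + L * sqrt (L\<^sup>2 / \<mu>\<^sup>2 - 3);
             r\<^sub>m = L\<^sup>2 / \<mu> - L * sqrt (L\<^sup>2 / \<mu>\<^sup>2 - 3)
         in 0 < r\<^sub>m \<and> r\<^sub>m < r\<^sub>p \<and>
            {r. local_extremum_on {0<..} (effective_potential \<mu> L) r} = {r\<^sub>m, r\<^sub>p} \<and>
            local_min_on {0<..} (effective_potential \<mu> L) r\<^sub>p \<and>
            local_max_on {0<..} (effective_potential \<mu> L) r\<^sub>m))"
proof (intro conjI impI)
  assume "L / \<mu> < sqrt 3"
  then have "(L / \<mu>)\<^sup>2 < (sqrt 3)\<^sup>2"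
    using assms by (intro power_strict_mono) auto
  then have lt: "L\<^sup>2 < 3 * \<mu>\<^sup>2"
    using assms by (simp add: power_divide divide_simps)
  show "\<nexists>r. local_extremum_on {0<..} (effective_potential \<mu> L) r"
  proof
    assume "\<exists>r. local_extremum_on {0<..} (effective_potential \<mu> L) r"
    then obtain r where "\<mu> * r\<^sup>2 - 2 * L\<^sup>2 * r + 3 * \<mu> * L\<^sup>2 = 0"
      using local_extremum_effective_potential_imp_quadratic(2) by blast
    \<comment> \<open>The factor \<open>\<mu>\<close> allows completing the square without
      fractions; the remainder is positive by \<open>lt\<close>.\<close>
    then have "\<mu> * (\<mu> * r\<^sup>2 - 2 * L\<^sup>2 * r + 3 * \<mu> * L\<^sup>2) = 0"
      by simp
    then have "(\<mu> * r - L\<^sup>2)\<^sup>2 + L\<^sup>2 * (3 * \<mu>\<^sup>2 - L\<^sup>2) = 0"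
      by (simp add: algebra_simps power2_eq_square)
    moreover have "0 < L\<^sup>2 * (3 * \<mu>\<^sup>2 - L\<^sup>2)"
      using assms lt by simp
    ultimately show False
      by (smt (verit) zero_le_power2)
  qed
next
  assume "L / \<mu> > sqrt 3"
  then have "(sqrt 3)\<^sup>2 < (L / \<mu>)\<^sup>2"
    by (intro power_strict_mono) auto
  then have gt: "3 < L\<^sup>2 / \<mu>\<^sup>2"
    by (simp add: power_divide)
  \<comment> \<open>\<open>a\<close> is the midpoint of the two roots and \<open>s\<close> half
    their distance, so the roots are \<open>a + s\<close> and \<open>a - s\<close>.\<close>
  define s where "s = L * sqrt (L\<^sup>2 / \<mu>\<^sup>2 - 3)"
  define a where "a = L\<^sup>2 / \<mu>"
  have s: "0 < s" and s2: "s\<^sup>2 = a\<^sup>2 - 3 * L\<^sup>2"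
    using assms gt by (simp_all add: s_def a_def power_mult_distrib field_simps power2_eq_square)
  have a: "3 * \<mu> < a"
    using assms gt by (simp add: a_def field_simps power2_eq_square)
  have L2: "L\<^sup>2 = \<mu> * a"
    using assms by (simp add: a_def)
  have prod: "(a + s) * (a - s) = 3 * \<mu> * a"
    using s2 L2 by (simp add: algebra_simps power2_eq_square)
  have factor: "\<mu> * r\<^sup>2 - 2 * L\<^sup>2 * r + 3 * \<mu> * L\<^sup>2 = \<mu> * (r - (a + s)) * (r - (a - s))" for r
  proof -
    have "\<mu> * (r - (a + s)) * (r - (a - s)) = \<mu> * (r\<^sup>2 - 2 * a * r + (a\<^sup>2 - s\<^sup>2))"
      by (simp add: algebra_simps power2_eq_square)
    also have "\<dots> = \<mu> * r\<^sup>2 - 2 * L\<^sup>2 * r + 3 * \<mu> * L\<^sup>2"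
      by (simp add: s2 L2 algebra_simps)
    finally show ?thesis by simp
  qed
  have a0: "0 < a" using a assms by simp
  have pos: "0 < a - s"
  proof -
    have "0 < (a + s) * (a - s)" unfolding prod using a0 assms by simp
    then show ?thesis using a0 s by (simp add: zero_less_mult_iff)
  qed
  \<comment> \<open>Shrinking the factor \<open>a + s\<close> to \<open>a\<close> in the product of
    the roots, which is \<open>3 * \<mu> * a\<close>, leaves a bound from which \<open>a\<close>
    cancels.\<close>
  have less: "a - s < 3 * \<mu>"
  proof -
    have "a * (a - s) < (a + s) * (a - s)" using s pos by simp
    then have "a * (a - s) < a * (3 * \<mu>)" using prod by (simp add: mult_ac)
    then show ?thesis using a0 by simp
  qed
  \<comment> \<open>The larger root lies beyond \<open>3 * \<mu>\<close> because the midpoint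
    \<open>a\<close> already does.\<close>
  have min: "local_min_on {0<..} (effective_potential \<mu> L) (a + s)"
    by (rule local_min_effective_potential) (use factor [of "a + s"] a a0 s in auto)
  have max: "local_max_on {0<..} (effective_potential \<mu> L) (a - s)"
    by (rule local_max_effective_potential) (use factor [of "a - s"] pos less in auto)
  have "r = a - s \<or> r = a + s" if "local_extremum_on {0<..} (effective_potential \<mu> L) r" for r
    using local_extremum_effective_potential_imp_quadratic(2) [OF that] assms
    unfolding factor by auto
  then have "{r. local_extremum_on {0<..} (effective_potential \<mu> L) r} = {a - s, a + s}"
    using min max by (auto simp: local_extremum_on_def)
  then show "let r\<^sub>p = L\<^sup>2 / \<mu> + L * sqrt (L\<^sup>2 / \<mu>\<^sup>2 - 3);
             r\<^sub>m = L\<^sup>2 / \<mu> - L * sqrt (L\<^sup>2 / \<mu>\<^sup>2 - 3)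
         in 0 < r\<^sub>m \<and> r\<^sub>m < r\<^sub>p \<and>
            {r. local_extremum_on {0<..} (effective_potential \<mu> L) r} = {r\<^sub>m, r\<^sub>p} \<and>
            local_min_on {0<..} (effective_potential \<mu> L) r\<^sub>p \<and>
            local_max_on {0<..} (effective_potential \<mu> L) r\<^sub>m"
    using min max pos s unfolding Let_def s_def [symmetric] a_def [symmetric] by simp
qed

end
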